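(* Let $M$ be a finitely generated abelian group, let $H$ be a subgroup of a group $G$, let $F$ be a group equipped with an epimorphism $\deg\colon F\to M$, and let $\Phi$ be a set of homomorphisms $F\to G$ satisfying the following conditions. (1) $\Phi$ is invariant with respect to conjugation by elements of $H$ (i.e. for $\phi\in\Phi$ and $h\in H$ the homomorphism $f\mapsto h^{-1}\phi(f)h$ belongs to $\Phi$). (2) For any $\phi\in\Phi$, each homomorphism $\psi\colon F\to G$ having the same tail as $\phi$ with respect to the quadruple $(F\twoheadrightarrow M;\ H\subset G)$ belongs to $\Phi$ too. Suppose also that, for each subgroup $H^*$ of $H$ and every action of the group $M$ on $H^*$, the number of crossed homomorphisms $M\to H^*$ is divisible by $|H^*|$. Then $|\Phi|$ is divisible by $|H|$.
   Context: All group actions are right actions; a group $M$ acts on a group $K$ by automorphisms, and the image of $h\in K$ under $a\in M$ is written $h^a$. A map $\alpha\colon M\to K$ is a crossed homomorphism if $\alpha(ab)=\alpha(a)^b\,\alpha(b)$ for all $a,b\in M$. Given a subgroup $H$ of a group $G$ and an epimorphism $\deg\colon F\to M$, the tail of a homomorphism $\phi\colon F\to G$ with respect to the quadruple $(F\twoheadrightarrow M;\ H\subset G)$ is the pair $(\phi_0,\phi_H)$, where $\phi_0$ is the restriction of $\phi$ to $\ker\deg\subset F$, and $\phi_H$ is the map from $F$ to the set of left cosets of $H$ in $G$ given by $f\mapsto\phi(f)H$. Finiteness of groups is not assumed unless stated. Divisibility is understood in the sense of cardinal arithmetic: an infinite cardinal is divisible by all nonzero cardinals not exceeding it, zero is divisible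 by all cardinals, and for finite cardinals divisibility is the usual one. *)

theory Defs
  imports "HOL-Algebra.Algebra" "HOL-Library.Equipollence"
begin

text \<open>
  Divisibility of cardinal numbers, stated for sets: the cardinality of \<open>A\<close> divides that of \<open>B\<close>.
  Note that a finite nonzero cardinal is not divisible by an infinite one.
\<close>

definition card_dvd :: "'a set \<Rightarrow> 'b set \<Rightarrow> bool" where
  "card_dvd A B \<longleftrightarrow>
     B = {} \<or>
     (finite A \<and> finite B \<and> card A dvd card B) \<or>
     (infinite B \<and> A \<noteq> {} \<and> A \<lesssim> B)"

definition finitely_generated_group :: "('m, 'x) monoid_scheme \<Rightarrow> bool" where
  "finitely_generated_group M \<longleftrightarrow>
     group M \<and> (\<exists>S. finite S \<and> S \<subseteq> carrier M \<and> generate M S = carrier M)"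

text \<open>
  The library's \<^const>\<open>hom\<close> does not constrain functions outside the carrier. To count homomorphisms,
  only extensional functions (\<open>undefined\<close> off the carrier) are admitted, so that
  each homomorphism corresponds to exactly one element.
\<close>

definition hom_ext :: "('f, 'x) monoid_scheme \<Rightarrow> ('g, 'y) monoid_scheme \<Rightarrow> ('f \<Rightarrow> 'g) set" where
  "hom_ext F G = hom F G \<inter> extensional (carrier F)"

text \<open>
  \<open>act a h\<close> stands for the image of \<open>h\<close> under \<open>a\<close>, written with \<open>a\<close> as a right superscript in the mathematics;
  as the action is on the right, \<open>a \<otimes> b\<close> applies \<open>a\<close> first.
\<close>

definition right_action_by_automorphisms ::
    "('m, 'x) monoid_scheme \<Rightarrow> ('g, 'y) monoid_scheme \<Rightarrow> ('m \<Rightarrow> 'g \<Rightarrow> 'g) \<Rightarrow> bool" where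
  "right_action_by_automorphisms M K act \<longleftrightarrow>
     (\<forall>a\<in>carrier M. act a \<in> iso K K) \<and>
     (\<forall>h\<in>carrier K. act \<one>\<^bsub>M\<^esub> h = h) \<and>
     (\<forall>a\<in>carrier M. \<forall>b\<in>carrier M. \<forall>h\<in>carrier K. act (a \<otimes>\<^bsub>M\<^esub> b) h = act b (act a h))"

definition crossed_homs ::
    "('m, 'x) monoid_scheme \<Rightarrow> ('g, 'y) monoid_scheme \<Rightarrow> ('m \<Rightarrow> 'g \<Rightarrow> 'g) \<Rightarrow> ('m \<Rightarrow> 'g) set" where
  "crossed_homs M K act =
     {\<alpha> \<in> carrier M \<rightarrow>\<^sub>E carrier K.
        \<forall>a\<in>carrier M. \<forall>b\<in>carrier M. \<alpha> (a \<otimes>\<^bsub>M\<^esub> b) = act b (\<alpha> a) \<otimes>\<^bsub>K\<^esub> \<alpha> b}"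

definition hom_tail ::
    "('f, 'x) monoid_scheme \<Rightarrow> ('m, 'y) monoid_scheme \<Rightarrow> ('f \<Rightarrow> 'm) \<Rightarrow>
     ('g, 'z) monoid_scheme \<Rightarrow> 'g set \<Rightarrow> ('f \<Rightarrow> 'g) \<Rightarrow> ('f \<Rightarrow> 'g) \<times> ('f \<Rightarrow> 'g set)" where
  "hom_tail F M dg G H \<phi> =
     (restrict \<phi> (kernel F M dg), (\<lambda>f\<in>carrier F. \<phi> f <#\<^bsub>G\<^esub> H))"

end

theory Submission
  imports Defs
begin

text \<open>
  The group \<open>H\<close> acts by conjugation on \<open>\<Phi>\<close>, and the tail of a conjugate depends only on the tail of
  the original homomorphism. If \<open>S\<close> is the stabilizer in \<open>H\<close> of the tail of \<open>\<phi>\<close>, then \<open>\<phi>(F)\<close> normalizes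
  \<open>S\<close> and \<open>\<phi>(ker deg)\<close> centralizes it, so that \<open>M\<close> acts on \<open>S\<close>; the homomorphisms with the same tail
  as \<open>\<phi>\<close> are exactly the maps \<open>f \<mapsto> \<phi>(f) \<alpha>(deg f)\<close> with \<open>\<alpha>: M \<rightarrow> S\<close> a crossed homomorphism. Their
  number is thus divisible by \<open>|S|\<close>, and taking the union over the orbit of the tail, of length
  \<open>|H : S|\<close>, yields a multiple of \<open>|H|\<close>.
\<close>

section \<open>Divisibility of cardinals\<close>

lemma card_dvd_bij_betw:
  assumes "card_dvd A B" and "bij_betw f B C"
  shows "card_dvd A C"
proof -
  have "finite B \<longleftrightarrow> finite C" "card B = card C" "B = {} \<longleftrightarrow> C = {}"
    using assms(2) by (auto simp: bij_betw_finite bij_betw_same_card bij_betw_def)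
  moreover have "lepoll A B \<Longrightarrow> lepoll A C"
    using assms(2) by (meson eqpoll_def eqpoll_imp_lepoll lepoll_trans)
  ultimately show ?thesis
    using assms(1) unfolding card_dvd_def by auto
qed

text \<open>For finite \<open>B\<close> a divisor of a positive number cannot exceed it; for
  infinite \<open>B\<close> the embedding is part of \<open>card_dvd\<close>. The empty set must be
  excluded, since it is divisible by everything.\<close>

lemma card_dvd_imp_lepoll:
  assumes "card_dvd A B" and "B \<noteq> {}"
  shows "lepoll A B"
proof (cases "finite B")
  case True
  then have "finite A" "card A dvd card B"
    using assms unfolding card_dvd_def by auto
  moreover have "card B > 0"
    using True assms(2) by (simp add: card_gt_0_iff)
  ultimately show ?thesis
    using True by (simp add: lepoll_iff_card_le dvd_imp_le)
next
  case False
  then show ?thesis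
    using assms unfolding card_dvd_def by auto
qed

section \<open>Counting in a set on which a group acts by permuting the fibres of a map\<close>

locale fibred_right_action = group K for K (structure) +
  fixes E :: "'x set" and act :: "'a \<Rightarrow> 'x \<Rightarrow> 'x" and \<tau> :: "'x \<Rightarrow> 't"
  assumes act_closed: "h \<in> carrier K \<Longrightarrow> x \<in> E \<Longrightarrow> act h x \<in> E"
    and act_one: "x \<in> E \<Longrightarrow> act \<one> x = x"
    and act_mult: "g \<in> carrier K \<Longrightarrow> h \<in> carrier K \<Longrightarrow> x \<in> E \<Longrightarrow> act (g \<otimes> h) x = act h (act g x)"
    \<comment> \<open>This makes the action descend to the values of \<open>\<tau>\<close> on
      \<open>E\<close>, without an action on the type \<open>'t\<close> being given.\<close>
    and act_fibre: "h \<in> carrier K \<Longrightarrow> x \<in> E \<Longrightarrow> y \<in> E \<Longrightarrow> \<tau> x = \<tau> y \<Longrightarrow> \<tau> (act h x) = \<tau> (act h y)"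
begin

definition fibre :: "'x \<Rightarrow> 'x set" where
  "fibre x = {y \<in> E. \<tau> y = \<tau> x}"

definition fibre_stabilizer :: "'x \<Rightarrow> 'a set" where
  "fibre_stabilizer x = {h \<in> carrier K. \<tau> (act h x) = \<tau> x}"

text \<open>The preimage in \<open>E\<close> of the orbit of \<open>\<tau> x\<close>, that is, the
  union of the fibres that meet the orbit of \<open>x\<close>.\<close>

definition saturated_orbit :: "'x \<Rightarrow> 'x set" where
  "saturated_orbit x = {y \<in> E. \<exists>h\<in>carrier K. \<tau> y = \<tau> (act h x)}"

lemma act_inv:
  assumes "h \<in> carrier K" "x \<in> E"
  shows "act (inv h) (act h x) = x" "act h (act (inv h) x) = x"
  using assms act_mult[of h "inv h" x] act_mult[of "inv h" h x] by (simp_all add: act_one)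

lemma act_inj_on: "h \<in> carrier K \<Longrightarrow> inj_on (act h) E"
  by (rule inj_on_inverseI[where g = "act (inv h)"]) (simp add: act_inv)

lemma fibre_act:
  assumes "h \<in> carrier K" "x \<in> E"
  shows "fibre (act h x) = act h ` fibre x"
proof
  show "act h ` fibre x \<subseteq> fibre (act h x)"
    using assms by (auto simp: fibre_def act_closed intro: act_fibre)
  show "fibre (act h x) \<subseteq> act h ` fibre x"
  proof
    fix y assume y: "y \<in> fibre (act h x)"
    then have "act (inv h) y \<in> fibre x"
      using assms act_fibre[of "inv h" y "act h x"]
      by (auto simp: fibre_def act_closed act_inv)
    moreover have "y = act h (act (inv h) y)"
      using assms y by (auto simp: fibre_def act_inv)
    ultimately show "y \<in> act h ` fibre x" by blast
  qed
qed

lemma same_fibre_iff: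
  assumes "h \<in> carrier K" "g \<in> carrier K" "x \<in> E"
  shows "\<tau> (act h x) = \<tau> (act g x) \<longleftrightarrow> h \<otimes> inv g \<in> fibre_stabilizer x"
proof
  assume "\<tau> (act h x) = \<tau> (act g x)"
  then have "\<tau> (act (inv g) (act h x)) = \<tau> (act (inv g) (act g x))"
    using assms by (intro act_fibre) (auto simp: act_closed)
  then show "h \<otimes> inv g \<in> fibre_stabilizer x"
    using assms by (simp add: fibre_stabilizer_def act_mult act_inv)
next
  assume "h \<otimes> inv g \<in> fibre_stabilizer x"
  then have "\<tau> (act (h \<otimes> inv g) x) = \<tau> x"
    by (simp add: fibre_stabilizer_def)
  then have "\<tau> (act g (act (h \<otimes> inv g) x)) = \<tau> (act g x)"
    using assms by (intro act_fibre) (auto simp: act_closed)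
  then show "\<tau> (act h x) = \<tau> (act g x)"
    using assms by (simp add: act_mult act_inv act_closed)
qed

text \<open>The usual correspondence between orbit points and cosets of the stabilizer, applied to
  the point \<open>\<tau> x\<close>; right cosets appear because the action is on the right.\<close>

lemma same_fibre_eq_r_coset:
  assumes "g \<in> carrier K" "x \<in> E"
  shows "{h \<in> carrier K. \<tau> (act h x) = \<tau> (act g x)} = fibre_stabilizer x #> g"
proof
  show "fibre_stabilizer x #> g \<subseteq> {h \<in> carrier K. \<tau> (act h x) = \<tau> (act g x)}"
    using assms by (auto simp: r_coset_def same_fibre_iff m_assoc fibre_stabilizer_def)
  show "{h \<in> carrier K. \<tau> (act h x) = \<tau> (act g x)} \<subseteq> fibre_stabilizer x #> g"
  proof
    fix h assume h: "h \<in> {h \<in> carrier K. \<tau> (act h x) = \<tau> (act g x)}"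
    then have "h \<otimes> inv g \<in> fibre_stabilizer x" "h = h \<otimes> inv g \<otimes> g"
      using assms same_fibre_iff[of h g x] by (auto simp: m_assoc)
    then show "h \<in> fibre_stabilizer x #> g"
      unfolding r_coset_def by blast
  qed
qed

text \<open>Double counting of the pairs \<open>(h, y)\<close> with
  \<open>\<tau> y = \<tau> (act h x)\<close>: for fixed \<open>h\<close> the \<open>y\<close> form a
  translate of the fibre of \<open>x\<close>, for fixed \<open>y\<close> the \<open>h\<close> form a
  right coset of the stabilizer. The product form avoids division by the order of the
  stabilizer.\<close>

lemma card_saturated_orbit:
  assumes "finite (carrier K)" "finite E" "x \<in> E"
  shows "card (carrier K) * card (fibre x) = card (saturated_orbit x) * card (fibre_stabilizer x)"
proof -
  let ?P = "SIGMA h:carrier K. fibre (act h x)"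
  let ?Q = "SIGMA y:saturated_orbit x. {h \<in> carrier K. \<tau> (act h x) = \<tau> y}"
  have fin: "finite (fibre y)" "finite (saturated_orbit y)" for y
    using assms(2) by (auto simp: fibre_def saturated_orbit_def)
  have "card (fibre (act h x)) = card (fibre x)" if "h \<in> carrier K" for h
    unfolding fibre_act[OF that assms(3)]
    by (intro card_image inj_on_subset[OF act_inj_on[OF that]]) (auto simp: fibre_def)
  then have P: "card ?P = card (carrier K) * card (fibre x)"
    using assms fin by simp
  have "card {h \<in> carrier K. \<tau> (act h x) = \<tau> y} = card (fibre_stabilizer x)"
    if "y \<in> saturated_orbit x" for y
  proof -
    obtain g where g: "g \<in> carrier K" "\<tau> y = \<tau> (act g x)"
      using \<open>y \<in> saturated_orbit x\<close> by (auto simp: saturated_orbit_def)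
    have "fibre_stabilizer x \<subseteq> carrier K"
      by (auto simp: fibre_stabilizer_def)
    then have "card (fibre_stabilizer x #> g) = card (fibre_stabilizer x)"
      using card_image[OF inj_on_g[OF _ g(1)]] by (simp add: r_coset_def UNION_singleton_eq_range)
    then show ?thesis
      using same_fibre_eq_r_coset[OF g(1) assms(3)] g(2) by simp
  qed
  then have Q: "card ?Q = card (saturated_orbit x) * card (fibre_stabilizer x)"
    using assms fin by simp
  have "?Q = prod.swap ` ?P"
    by (auto simp: fibre_def saturated_orbit_def image_iff)
  then have "card ?Q = card ?P"
    by (simp add: card_image)
  with P Q show ?thesis by simp
qed

text \<open>Each \<open>h\<close> factors as \<open>s \<otimes> r h\<close> with \<open>r h\<close>
  a chosen representative of its coset and \<open>s\<close> in the stabilizer. Sending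
  \<open>h\<close> to \<open>act (r h) (i s)\<close> is injective: the fibre of the image determines
  \<open>r h\<close>, and then \<open>i\<close> determines \<open>s\<close>. No finiteness is
  involved.\<close>

lemma carrier_lepoll:
  assumes "x \<in> E" and "lepoll (fibre_stabilizer x) (fibre x)"
  shows "lepoll (carrier K) E"
proof -
  obtain i where i: "inj_on i (fibre_stabilizer x)" "i ` fibre_stabilizer x \<subseteq> fibre x"
    using assms(2) by (auto simp: lepoll_def)
  \<comment> \<open>The choice depends on \<open>h\<close> only through
    \<open>\<tau> (act h x)\<close>, so elements of one coset get literally the same
    representative.\<close>
  define r where "r h = (SOME g. g \<in> carrier K \<and> \<tau> (act g x) = \<tau> (act h x))" for h
  have r: "r h \<in> carrier K" "\<tau> (act (r h) x) = \<tau> (act h x)" if "h \<in> carrier K" for h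
    using someI[of "\<lambda>g. g \<in> carrier K \<and> \<tau> (act g x) = \<tau> (act h x)" h] that
    unfolding r_def by auto
  define j where "j h = act (r h) (i (h \<otimes> inv (r h)))" for h
  have s: "h \<otimes> inv (r h) \<in> fibre_stabilizer x" if "h \<in> carrier K" for h
    using same_fibre_iff r that assms(1) by metis
  have iX: "i (h \<otimes> inv (r h)) \<in> E" "\<tau> (i (h \<otimes> inv (r h))) = \<tau> x" if "h \<in> carrier K" for h
    using s[OF that] i(2) by (auto simp: fibre_def)
  have \<tau>j: "\<tau> (j h) = \<tau> (act h x)" if "h \<in> carrier K" for h
    using act_fibre[OF r(1)[OF that] iX(1)[OF that] assms(1) iX(2)[OF that]] r(2)[OF that]
    by (simp add: j_def)
  have "inj_on j (carrier K)"
  proof (rule inj_onI)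
    fix g h assume gh: "g \<in> carrier K" "h \<in> carrier K" "j g = j h"
    then have "\<tau> (act g x) = \<tau> (act h x)"
      using \<tau>j by metis
    then have rr: "r g = r h"
      by (simp add: r_def)
    then have "i (g \<otimes> inv (r h)) = i (h \<otimes> inv (r h))"
      using gh act_inj_on[OF r(1)[OF gh(2)]] iX[OF gh(1)] iX[OF gh(2)]
      by (simp add: j_def inj_on_def)
    then have "g \<otimes> inv (r h) = h \<otimes> inv (r h)"
      using inj_onD[OF i(1)] s[OF gh(1)] s[OF gh(2)] rr by simp
    then show "g = h"
      using gh r(1) by simp
  qed
  moreover have "j ` carrier K \<subseteq> E"
    using r iX by (auto simp: j_def act_closed)
  ultimately show ?thesis
    by (auto simp: lepoll_def)
qed

text \<open>If \<open>\<tau> z = \<tau> (act g x)\<close>, left multiplication by \<open>g\<close>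
  turns a parametrization of the orbit from \<open>z\<close> into one from \<open>x\<close>. Hence
  saturated orbits partition \<open>E\<close>.\<close>

lemma saturated_orbit_eq:
  assumes "x \<in> E" "z \<in> saturated_orbit x"
  shows "saturated_orbit z = saturated_orbit x"
proof -
  obtain g where g: "z \<in> E" "g \<in> carrier K" "\<tau> z = \<tau> (act g x)"
    using assms(2) by (auto simp: saturated_orbit_def)
  have trans: "\<tau> (act h z) = \<tau> (act (g \<otimes> h) x)" if "h \<in> carrier K" for h
    using act_fibre[OF that g(1) _ g(3)] g assms(1) that by (simp add: act_closed act_mult)
  have "\<tau> (act h x) = \<tau> (act (inv g \<otimes> h) z)" if "h \<in> carrier K" for h
    using trans[of "inv g \<otimes> h"] g that by (simp add: m_assoc[symmetric])
  moreover have "g \<otimes> h \<in> carrier K" "inv g \<otimes> h \<in> carrier K" if "h \<in> carrier K" for h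
    using g(2) that by simp_all
  ultimately have "(\<exists>h\<in>carrier K. \<tau> y = \<tau> (act h z)) \<longleftrightarrow> (\<exists>h\<in>carrier K. \<tau> y = \<tau> (act h x))" for y
    using trans by metis
  then show ?thesis
    by (simp add: saturated_orbit_def)
qed

text \<open>For infinite \<open>E\<close> the embedding of the group suffices. For finite
  \<open>E\<close> the group is finite too, and the double count shows each block of the partition
  into saturated orbits to be a multiple of its order.\<close>

theorem card_dvd_carrier:
  assumes dvd: "\<And>x. x \<in> E \<Longrightarrow> card_dvd (fibre_stabilizer x) (fibre x)"
  shows "card_dvd (carrier K) E"
proof (cases "E = {}")
  case True
  then show ?thesis by (simp add: card_dvd_def)
next
  case False
  then obtain x where x: "x \<in> E" by blast
  then have "fibre x \<noteq> {}"
    by (auto simp: fibre_def)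
  with dvd[OF x] have "lepoll (fibre_stabilizer x) (fibre x)"
    by (rule card_dvd_imp_lepoll)
  then have le: "lepoll (carrier K) E"
    by (rule carrier_lepoll[OF x])
  show ?thesis
  proof (cases "finite E")
    case False
    then show ?thesis
      using le by (auto simp: card_dvd_def)
  next
    case True
    then have finK: "finite (carrier K)"
      using le by (metis finite_surj lepoll_iff)
    have "card (carrier K) dvd card (saturated_orbit y)" if y: "y \<in> E" for y
    proof -
      have "finite (fibre y)" "fibre y \<noteq> {}"
        using True y by (auto simp: fibre_def)
      then have "card (fibre_stabilizer y) dvd card (fibre y)"
        using dvd[OF y] by (auto simp: card_dvd_def)
      then obtain k where k: "card (fibre y) = card (fibre_stabilizer y) * k" ..
      \<comment> \<open>Positivity of this order is what permits cancelling it in the double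
        count.\<close>
      have "\<one> \<in> fibre_stabilizer y" "finite (fibre_stabilizer y)"
        using y finK by (auto simp: fibre_stabilizer_def act_one)
      then have "card (fibre_stabilizer y) > 0"
        by (auto simp: card_gt_0_iff)
      then have "card (saturated_orbit y) = card (carrier K) * k"
        using card_saturated_orbit[OF finK True y] k by (simp add: mult.left_commute)
      then show ?thesis by simp
    qed
    moreover have "pairwise disjnt (saturated_orbit ` E)"
    proof (clarsimp simp: pairwise_def disjnt_iff)
      fix y z w
      assume "y \<in> E" "z \<in> E" "w \<in> saturated_orbit y" "w \<in> saturated_orbit z"
      then have "saturated_orbit y = saturated_orbit z"
        using saturated_orbit_eq by metis
      moreover assume "saturated_orbit y \<noteq> saturated_orbit z"
      ultimately show False by contradiction
    qed
    moreover have "y \<in> saturated_orbit y" if "y \<in> E" for y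
      using that one_closed act_one[OF that] unfolding saturated_orbit_def by force
    then have "\<Union> (saturated_orbit ` E) = E"
      by (auto simp: saturated_orbit_def)
    moreover have "finite (saturated_orbit y)" for y
      using True by (simp add: saturated_orbit_def)
    ultimately have "card E = sum card (saturated_orbit ` E)"
      and "card (carrier K) dvd sum card (saturated_orbit ` E)"
      using card_Union_disjoint[of "saturated_orbit ` E"] by (auto intro: dvd_sum)
    then show ?thesis
      using True finK by (simp add: card_dvd_def)
  qed
qed

end

section \<open>Conjugation and left cosets\<close>

context group
begin

text \<open>The exponent notation \<open>x^g\<close>; with the inverse on the left, conjugation is a
  right action.\<close>

abbreviation conj_by :: "'a \<Rightarrow> 'a \<Rightarrow> 'a" where
  "conj_by g x \<equiv> inv g \<otimes> x \<otimes> g"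

text \<open>Cancellation in the right-associated form that rewriting with \<open>m_assoc\<close>
  produces.\<close>

lemma inv_mult_cancel_left:
  assumes "x \<in> carrier G" "y \<in> carrier G"
  shows "inv x \<otimes> (x \<otimes> y) = y" "x \<otimes> (inv x \<otimes> y) = y"
  using assms by (simp_all add: m_assoc[symmetric])

lemma conj_by_mult:
  assumes "g \<in> carrier G" "x \<in> carrier G" "y \<in> carrier G"
  shows "conj_by g (x \<otimes> y) = conj_by g x \<otimes> conj_by g y"
  using assms by (simp add: m_assoc inv_mult_cancel_left)

lemma conj_by_inv:
  assumes "g \<in> carrier G" "x \<in> carrier G"
  shows "conj_by g (inv x) = inv (conj_by g x)"
  using assms by (simp add: m_assoc inv_mult_group)

lemma conj_by_conj_by:
  assumes "g \<in> carrier G" "h \<in> carrier G" "x \<in> carrier G"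
  shows "conj_by h (conj_by g x) = conj_by (g \<otimes> h) x"
  using assms by (simp add: m_assoc inv_mult_group)

lemma conj_by_eq_iff_commute:
  assumes "g \<in> carrier G" "x \<in> carrier G"
  shows "conj_by g x = x \<longleftrightarrow> x \<otimes> g = g \<otimes> x"
  using assms by (metis inv_mult_cancel_left m_assoc m_closed inv_closed)

lemma l_coset_eq_iff:
  assumes "subgroup H G" "x \<in> carrier G" "y \<in> carrier G"
  shows "y <# H = x <# H \<longleftrightarrow> inv x \<otimes> y \<in> H"
proof
  assume "y <# H = x <# H"
  then have "y \<in> x <# H"
    using assms by (metis lcos_self)
  then show "inv x \<otimes> y \<in> H"
    using assms subgroup.subset[OF assms(1)]
    by (auto simp: l_coset_def inv_mult_cancel_left subset_iff)
next
  assume "inv x \<otimes> y \<in> H"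
  then have "y \<in> x <# H"
    using assms inv_mult_cancel_left(2)[of x y] unfolding l_coset_def by force
  then show "y <# H = x <# H"
    using assms l_repr_independence by metis
qed

end

section \<open>Homomorphisms with a given tail as crossed homomorphisms\<close>

locale tailed_hom =
  M: group M + F: group F + G: group G
  for M :: "('m, 'x) monoid_scheme" (structure)
    and F :: "('f, 'y) monoid_scheme" (structure)
    and G :: "('g, 'z) monoid_scheme" (structure) +
  fixes H :: "'g set" and dg :: "'f \<Rightarrow> 'm" and \<phi> :: "'f \<Rightarrow> 'g"
  assumes H: "subgroup H G" and dg: "dg \<in> epi F M" and \<phi>: "\<phi> \<in> hom F G"
begin

lemma H_carrier: "h \<in> H \<Longrightarrow> h \<in> carrier G"
  using H subgroup.mem_carrier by metis

lemma \<phi>_closed [simp]: "f \<in> carrier F \<Longrightarrow> \<phi> f \<in> carrier G"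
  using \<phi> by (auto simp: hom_def)

lemma \<phi>_mult: "f \<in> carrier F \<Longrightarrow> g \<in> carrier F \<Longrightarrow> \<phi> (f \<otimes>\<^bsub>F\<^esub> g) = \<phi> f \<otimes>\<^bsub>G\<^esub> \<phi> g"
  using \<phi> by (auto simp: hom_def)

lemma dg_hom: "group_hom F M dg"
  using dg by (auto simp: epi_def group_hom_def group_hom_axioms_def M.is_group F.is_group)

lemma \<phi>_hom: "group_hom F G \<phi>"
  using \<phi> by (auto simp: group_hom_def group_hom_axioms_def G.is_group F.is_group)

lemma dg_closed [simp]: "f \<in> carrier F \<Longrightarrow> dg f \<in> carrier M"
  and dg_mult: "f \<in> carrier F \<Longrightarrow> g \<in> carrier F \<Longrightarrow> dg (f \<otimes>\<^bsub>F\<^esub> g) = dg f \<otimes>\<^bsub>M\<^esub> dg g"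
  using dg by (auto simp: epi_def hom_def)

lemma dg_surj: "a \<in> carrier M \<Longrightarrow> \<exists>f\<in>carrier F. dg f = a"
  using dg by (auto simp: epi_def) (metis imageE)

lemma kernel_iff: "k \<in> kernel F M dg \<longleftrightarrow> k \<in> carrier F \<and> dg k = \<one>\<^bsub>M\<^esub>"
  by (auto simp: kernel_def)

lemma kernel_closed [simp]: "k \<in> kernel F M dg \<Longrightarrow> k \<in> carrier F"
  by (simp add: kernel_iff)

lemma same_degree_kernel:
  assumes "f \<in> carrier F" "g \<in> carrier F" "dg f = dg g"
  shows "inv\<^bsub>F\<^esub> f \<otimes>\<^bsub>F\<^esub> g \<in> kernel F M dg"
  using assms by (simp add: kernel_iff dg_mult group_hom.hom_inv[OF dg_hom])

lemma conj_kernel: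
  assumes "f \<in> carrier F" "k \<in> kernel F M dg"
  shows "f \<otimes>\<^bsub>F\<^esub> k \<otimes>\<^bsub>F\<^esub> inv\<^bsub>F\<^esub> f \<in> kernel F M dg"
  using assms by (simp add: kernel_iff dg_mult group_hom.hom_inv[OF dg_hom])

text \<open>Equality of tails with the fixed \<open>\<phi>\<close>, with cosets replaced by
  quotients: these quotients will be the values of the crossed homomorphism.\<close>

definition same_tail :: "('f \<Rightarrow> 'g) \<Rightarrow> bool" where
  "same_tail \<psi> \<longleftrightarrow> (\<forall>k\<in>kernel F M dg. \<psi> k = \<phi> k) \<and> (\<forall>f\<in>carrier F. inv\<^bsub>G\<^esub> \<phi> f \<otimes>\<^bsub>G\<^esub> \<psi> f \<in> H)"

lemma hom_tail_eq_iff: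
  assumes "\<psi> \<in> carrier F \<rightarrow> carrier G"
  shows "hom_tail F M dg G H \<psi> = hom_tail F M dg G H \<phi> \<longleftrightarrow> same_tail \<psi>"
proof -
  have "restrict \<psi> (kernel F M dg) = restrict \<phi> (kernel F M dg) \<longleftrightarrow> (\<forall>k\<in>kernel F M dg. \<psi> k = \<phi> k)"
    by (auto simp: fun_eq_iff restrict_def)
  moreover have "(\<lambda>f\<in>carrier F. \<psi> f <#\<^bsub>G\<^esub> H) = (\<lambda>f\<in>carrier F. \<phi> f <#\<^bsub>G\<^esub> H)
      \<longleftrightarrow> (\<forall>f\<in>carrier F. \<psi> f <#\<^bsub>G\<^esub> H = \<phi> f <#\<^bsub>G\<^esub> H)"
    by (auto simp: fun_eq_iff restrict_def)
  ultimately show ?thesis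
    using assms by (auto simp: hom_tail_def same_tail_def G.l_coset_eq_iff[OF H] Pi_iff)
qed

text \<open>The centralizer of \<open>\<phi>(ker dg)\<close> in the largest subgroup of
  \<open>H\<close> normalized by \<open>\<phi>(F)\<close>.\<close>

definition tail_stabilizer :: "'g set" where
  "tail_stabilizer = {h \<in> H. (\<forall>f\<in>carrier F. G.conj_by (\<phi> f) h \<in> H) \<and>
     (\<forall>k\<in>kernel F M dg. G.conj_by (\<phi> k) h = h)}"

lemma tail_stabilizer_carrier: "h \<in> tail_stabilizer \<Longrightarrow> h \<in> carrier G"
  by (simp add: tail_stabilizer_def H_carrier)

text \<open>On the kernel, fixing \<open>\<phi> k\<close> under \<open>h\<close> and fixing
  \<open>h\<close> under \<open>\<phi> k\<close> both mean commuting. For cosets, the quotient of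
  the conjugate by \<open>\<phi> f\<close> is \<open>c^{-1} h\<close> with
  \<open>c = h^{\<phi> f}\<close>, and since \<open>h\<close> is in \<open>H\<close> this lies in
  \<open>H\<close> exactly when \<open>c\<close> does.\<close>

lemma same_tail_conj_iff:
  assumes h: "h \<in> H"
  shows "same_tail (\<lambda>f\<in>carrier F. G.conj_by h (\<phi> f)) \<longleftrightarrow> h \<in> tail_stabilizer"
proof -
  have hG: "h \<in> carrier G" using h by (rule H_carrier)
  have "G.conj_by h (\<phi> k) = \<phi> k \<longleftrightarrow> G.conj_by (\<phi> k) h = h" if "k \<in> carrier F" for k
    using that hG by (auto simp: G.conj_by_eq_iff_commute)
  moreover have "inv\<^bsub>G\<^esub> \<phi> f \<otimes>\<^bsub>G\<^esub> G.conj_by h (\<phi> f) \<in> H \<longleftrightarrow> G.conj_by (\<phi> f) h \<in> H"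
    if "f \<in> carrier F" for f
  proof -
    let ?c = "G.conj_by (\<phi> f) h"
    have c: "?c \<in> carrier G" using that hG by simp
    have "inv\<^bsub>G\<^esub> \<phi> f \<otimes>\<^bsub>G\<^esub> G.conj_by h (\<phi> f) = inv\<^bsub>G\<^esub> ?c \<otimes>\<^bsub>G\<^esub> h"
      using that hG by (simp add: G.m_assoc G.inv_mult_group)
    moreover have "inv\<^bsub>G\<^esub> ?c \<otimes>\<^bsub>G\<^esub> h \<in> H \<longleftrightarrow> ?c \<in> H"
    proof
      assume "inv\<^bsub>G\<^esub> ?c \<otimes>\<^bsub>G\<^esub> h \<in> H"
      then have "h \<otimes>\<^bsub>G\<^esub> inv\<^bsub>G\<^esub> (inv\<^bsub>G\<^esub> ?c \<otimes>\<^bsub>G\<^esub> h) \<in> H"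
        using h H by (simp add: subgroup.m_closed subgroup.m_inv_closed)
      then show "?c \<in> H"
        using c hG by (simp add: G.inv_mult_group G.inv_mult_cancel_left)
    qed (use h H in \<open>simp add: subgroup.m_closed subgroup.m_inv_closed\<close>)
    ultimately show ?thesis by simp
  qed
  ultimately show ?thesis
    using h by (auto simp: same_tail_def tail_stabilizer_def)
qed

lemma subgroup_tail_stabilizer: "subgroup tail_stabilizer (G\<lparr>carrier := H\<rparr>)"
proof -
  have "subgroup tail_stabilizer G"
  proof (rule G.subgroupI)
    show "tail_stabilizer \<subseteq> carrier G"
      using tail_stabilizer_carrier by blast
    have "\<one>\<^bsub>G\<^esub> \<in> tail_stabilizer"
      using H by (auto simp: tail_stabilizer_def subgroup.one_closed)
    then show "tail_stabilizer \<noteq> {}" by blast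
    show "inv\<^bsub>G\<^esub> a \<in> tail_stabilizer" if "a \<in> tail_stabilizer" for a
      using that tail_stabilizer_carrier[OF that] H
      by (auto simp: tail_stabilizer_def G.conj_by_inv subgroup.m_inv_closed)
    show "a \<otimes>\<^bsub>G\<^esub> b \<in> tail_stabilizer" if "a \<in> tail_stabilizer" "b \<in> tail_stabilizer" for a b
      using that tail_stabilizer_carrier[OF that(1)] tail_stabilizer_carrier[OF that(2)] H
      by (auto simp: tail_stabilizer_def G.conj_by_mult subgroup.m_closed)
  qed
  then show ?thesis
    using H by (intro G.subgroup_incl) (auto simp: tail_stabilizer_def)
qed

text \<open>Normality of the kernel is the point: \<open>f k = k' f\<close> with
  \<open>k' = f k f^{-1}\<close> in the kernel, so conjugating \<open>h\<close> by
  \<open>\<phi> f\<close> and then by \<open>\<phi> k\<close> equals conjugating first by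
  \<open>\<phi> k'\<close>, which fixes \<open>h\<close>.\<close>

lemma tail_stabilizer_conj_closed:
  assumes h: "h \<in> tail_stabilizer" and f: "f \<in> carrier F"
  shows "G.conj_by (\<phi> f) h \<in> tail_stabilizer"
proof -
  have hG: "h \<in> carrier G" using h by (rule tail_stabilizer_carrier)
  have "G.conj_by (\<phi> g) (G.conj_by (\<phi> f) h) \<in> H" if "g \<in> carrier F" for g
    using h f that hG by (simp add: G.conj_by_conj_by \<phi>_mult[symmetric] tail_stabilizer_def)
  moreover have "G.conj_by (\<phi> k) (G.conj_by (\<phi> f) h) = G.conj_by (\<phi> f) h"
    if k: "k \<in> kernel F M dg" for k
  proof -
    let ?k = "f \<otimes>\<^bsub>F\<^esub> k \<otimes>\<^bsub>F\<^esub> inv\<^bsub>F\<^esub> f"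
    have "f \<otimes>\<^bsub>F\<^esub> k = ?k \<otimes>\<^bsub>F\<^esub> f"
      using f k by (simp add: F.m_assoc)
    then have "G.conj_by (\<phi> k) (G.conj_by (\<phi> f) h) = G.conj_by (\<phi> f) (G.conj_by (\<phi> ?k) h)"
      using f k hG by (simp add: G.conj_by_conj_by \<phi>_mult[symmetric])
    then show ?thesis
      using h conj_kernel[OF f k] by (simp add: tail_stabilizer_def)
  qed
  ultimately show ?thesis
    using h f by (simp add: tail_stabilizer_def)
qed

definition tail_action :: "'m \<Rightarrow> 'g \<Rightarrow> 'g" where
  "tail_action a h = G.conj_by (\<phi> (inv_into (carrier F) dg a)) h"

text \<open>Two lifts of an element of \<open>M\<close> differ by a kernel element, whose image
  centralizes the stabilizer. So the lift chosen by \<open>inv_into\<close> may be replaced by any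
  other.\<close>

lemma tail_action_dg:
  assumes h: "h \<in> tail_stabilizer" and f: "f \<in> carrier F"
  shows "tail_action (dg f) h = G.conj_by (\<phi> f) h"
proof -
  let ?g = "inv_into (carrier F) dg (dg f)"
  have g: "?g \<in> carrier F" "dg ?g = dg f"
    using f by (auto intro: inv_into_into f_inv_into_f)
  let ?k = "inv\<^bsub>F\<^esub> f \<otimes>\<^bsub>F\<^esub> ?g"
  have k: "?k \<in> kernel F M dg"
    using f g by (intro same_degree_kernel) auto
  have "\<phi> ?g = \<phi> f \<otimes>\<^bsub>G\<^esub> \<phi> ?k"
    using f g by (simp add: \<phi>_mult[symmetric] F.inv_mult_cancel_left)
  then have "G.conj_by (\<phi> ?g) h = G.conj_by (\<phi> ?k) (G.conj_by (\<phi> f) h)"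
    using f k h by (simp add: G.conj_by_conj_by tail_stabilizer_carrier)
  then show ?thesis
    using tail_stabilizer_conj_closed[OF h f] k by (simp add: tail_action_def tail_stabilizer_def)
qed

lemma right_action_tail_action:
  "right_action_by_automorphisms M (G\<lparr>carrier := tail_stabilizer\<rparr>) tail_action"
proof -
  have "tail_action a \<in> iso (G\<lparr>carrier := tail_stabilizer\<rparr>) (G\<lparr>carrier := tail_stabilizer\<rparr>)"
    if "a \<in> carrier M" for a
  proof -
    obtain f where f: "f \<in> carrier F" "a = dg f"
      using dg_surj \<open>a \<in> carrier M\<close> by blast
    have "tail_action a \<in> hom (G\<lparr>carrier := tail_stabilizer\<rparr>) (G\<lparr>carrier := tail_stabilizer\<rparr>)"
      using f subgroup.m_closed[OF subgroup_tail_stabilizer]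
      by (auto simp: hom_def tail_action_dg tail_stabilizer_conj_closed tail_stabilizer_carrier
          G.conj_by_mult)
    moreover have "bij_betw (tail_action a) tail_stabilizer tail_stabilizer"
    \<comment> \<open>The inverse automorphism is conjugation by the image of the inverse
      lift.\<close>
    proof (rule bij_betw_byWitness[where f' = "G.conj_by (\<phi> (inv\<^bsub>F\<^esub> f))"])
      have 1: "G.conj_by \<one>\<^bsub>G\<^esub> h = h" if "h \<in> tail_stabilizer" for h
        using tail_stabilizer_carrier[OF that] by simp
      have 2: "\<phi> f \<otimes>\<^bsub>G\<^esub> \<phi> (inv\<^bsub>F\<^esub> f) = \<one>\<^bsub>G\<^esub>" "\<phi> (inv\<^bsub>F\<^esub> f) \<otimes>\<^bsub>G\<^esub> \<phi> f = \<one>\<^bsub>G\<^esub>"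
        using f by (simp_all add: \<phi>_mult[symmetric] group_hom.hom_one[OF \<phi>_hom])
      show "\<forall>h\<in>tail_stabilizer. G.conj_by (\<phi> (inv\<^bsub>F\<^esub> f)) (tail_action a h) = h"
        using f 1 2 by (simp add: tail_action_dg G.conj_by_conj_by tail_stabilizer_carrier)
      show "\<forall>h\<in>tail_stabilizer. tail_action a (G.conj_by (\<phi> (inv\<^bsub>F\<^esub> f)) h) = h"
        using f 1 2 by (simp add: tail_action_dg tail_stabilizer_conj_closed G.conj_by_conj_by
            tail_stabilizer_carrier)
    qed (use f in \<open>auto simp: tail_action_dg tail_stabilizer_conj_closed\<close>)
    ultimately show ?thesis by (simp add: iso_def)
  qed
  moreover have "tail_action \<one>\<^bsub>M\<^esub> h = h" if "h \<in> tail_stabilizer" for h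
    using tail_action_dg[OF that, of "\<one>\<^bsub>F\<^esub>"] tail_stabilizer_carrier[OF that]
    by (simp add: group_hom.hom_one[OF \<phi>_hom] group_hom.hom_one[OF dg_hom])
  moreover have "tail_action (a \<otimes>\<^bsub>M\<^esub> b) h = tail_action b (tail_action a h)"
    if "a \<in> carrier M" "b \<in> carrier M" and h: "h \<in> tail_stabilizer" for a b h
  proof -
    obtain f g where fg: "f \<in> carrier F" "a = dg f" "g \<in> carrier F" "b = dg g"
      using dg_surj \<open>a \<in> carrier M\<close> \<open>b \<in> carrier M\<close> by metis
    then show ?thesis
      using h by (simp add: dg_mult[symmetric] tail_action_dg tail_stabilizer_conj_closed
          G.conj_by_conj_by tail_stabilizer_carrier \<phi>_mult)
  qed
  ultimately show ?thesis
    by (simp add: right_action_by_automorphisms_def)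
qed

text \<open>The quotient \<open>q\<close> of two homomorphisms satisfies the crossed law for
  conjugation through \<open>\<phi>\<close>. As \<open>q\<close> is trivial on the kernel, this law
  forces its values into \<open>tail_stabilizer\<close> and makes \<open>q\<close> factor through
  \<open>dg\<close>.\<close>

lemma quotient_of_same_tail:
  assumes \<psi>: "\<psi> \<in> hom F G" and tail: "same_tail \<psi>"
  defines "q f \<equiv> inv\<^bsub>G\<^esub> \<phi> f \<otimes>\<^bsub>G\<^esub> \<psi> f"
  shows "f \<in> carrier F \<Longrightarrow> g \<in> carrier F \<Longrightarrow> q (f \<otimes>\<^bsub>F\<^esub> g) = G.conj_by (\<phi> g) (q f) \<otimes>\<^bsub>G\<^esub> q g"
    and "f \<in> carrier F \<Longrightarrow> q f \<in> tail_stabilizer"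
    and "f \<in> carrier F \<Longrightarrow> g \<in> carrier F \<Longrightarrow> dg f = dg g \<Longrightarrow> q f = q g"
proof -
  have \<psi>_closed [simp]: "\<psi> f \<in> carrier G" if "f \<in> carrier F" for f
    using that \<psi> by (auto simp: hom_def)
  have \<psi>_mult: "\<psi> (f \<otimes>\<^bsub>F\<^esub> g) = \<psi> f \<otimes>\<^bsub>G\<^esub> \<psi> g" if "f \<in> carrier F" "g \<in> carrier F" for f g
    using that \<psi> by (auto simp: hom_def)
  have q_closed [simp]: "q f \<in> carrier G" if "f \<in> carrier F" for f
    using that by (simp add: q_def)
  have q_H: "q f \<in> H" if "f \<in> carrier F" for f
    using that tail by (simp add: same_tail_def q_def)
  have q_ker: "q k = \<one>\<^bsub>G\<^esub>" if "k \<in> kernel F M dg" for k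
    using that tail by (simp add: same_tail_def q_def)
  show q_mult: "q (f \<otimes>\<^bsub>F\<^esub> g) = G.conj_by (\<phi> g) (q f) \<otimes>\<^bsub>G\<^esub> q g"
    if "f \<in> carrier F" "g \<in> carrier F" for f g
    using that by (simp add: q_def \<phi>_mult \<psi>_mult G.inv_mult_group G.m_assoc G.inv_mult_cancel_left)
  have conj_q: "G.conj_by (\<phi> k) (q f) = q f" if f: "f \<in> carrier F" and k: "k \<in> kernel F M dg" for f k
  proof -
    \<comment> \<open>Expanding \<open>q\<close> at \<open>f k = ?k f\<close> in both ways, with
      \<open>q k\<close> and \<open>q ?k\<close> trivial, leaves
      \<open>q(f)^{\<phi> k} = q f\<close>.\<close>
    let ?k = "f \<otimes>\<^bsub>F\<^esub> k \<otimes>\<^bsub>F\<^esub> inv\<^bsub>F\<^esub> f"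
    have k': "?k \<in> kernel F M dg" by (rule conj_kernel[OF f k])
    have "q (f \<otimes>\<^bsub>F\<^esub> k) = q (?k \<otimes>\<^bsub>F\<^esub> f)"
      using f k by (simp add: F.m_assoc)
    then have "G.conj_by (\<phi> k) (q f) \<otimes>\<^bsub>G\<^esub> q k = G.conj_by (\<phi> f) (q ?k) \<otimes>\<^bsub>G\<^esub> q f"
      by (simp only: q_mult[OF f kernel_closed[OF k]] q_mult[OF kernel_closed[OF k'] f])
    then show ?thesis
      unfolding q_ker[OF k] q_ker[OF k'] using f k by simp
  qed
  show "q f \<in> tail_stabilizer" if f: "f \<in> carrier F" for f
  proof -
    have "G.conj_by (\<phi> g) (q f) \<in> H" if g: "g \<in> carrier F" for g
    proof -
      \<comment> \<open>The crossed law solved for the conjugate: a quotient of two values of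
        \<open>q\<close>, all of which lie in \<open>H\<close>.\<close>
      have "G.conj_by (\<phi> g) (q f) = q (f \<otimes>\<^bsub>F\<^esub> g) \<otimes>\<^bsub>G\<^esub> inv\<^bsub>G\<^esub> q g"
        using f g by (simp add: q_mult G.m_assoc)
      then show ?thesis
        using f g H by (simp add: q_H subgroup.m_closed subgroup.m_inv_closed)
    qed
    then show ?thesis
      using f q_H conj_q by (simp add: tail_stabilizer_def)
  qed
  show "q f = q g" if f: "f \<in> carrier F" and g: "g \<in> carrier F" and "dg f = dg g" for f g
  proof -
    let ?k = "inv\<^bsub>F\<^esub> f \<otimes>\<^bsub>F\<^esub> g"
    have k: "?k \<in> kernel F M dg"
      using same_degree_kernel that by blast
    have "q g = q (f \<otimes>\<^bsub>F\<^esub> ?k)"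
      using f g by (simp add: F.inv_mult_cancel_left)
    also have "\<dots> = q f"
      unfolding q_mult[OF f kernel_closed[OF k]] conj_q[OF f k] q_ker[OF k] using f by simp
    finally show ?thesis ..
  qed
qed

text \<open>The crossed law for \<open>\<alpha>\<close> is exactly multiplicativity of
  \<open>f \<mapsto> \<phi>(f) \<alpha>(dg f)\<close>, and the inverse map sends
  \<open>\<psi>\<close> to the quotient of \<open>\<psi>\<close> by \<open>\<phi>\<close>, descended
  to \<open>M\<close>.\<close>

lemma bij_betw_crossed_homs_same_tail:
  "bij_betw (\<lambda>\<alpha>. \<lambda>f\<in>carrier F. \<phi> f \<otimes>\<^bsub>G\<^esub> \<alpha> (dg f))
     (crossed_homs M (G\<lparr>carrier := tail_stabilizer\<rparr>) tail_action)
     {\<psi> \<in> hom_ext F G. same_tail \<psi>}"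
  (is "bij_betw ?T ?A ?B")
proof -
  have \<alpha>_in: "\<alpha> (dg f) \<in> tail_stabilizer" if "\<alpha> \<in> ?A" "f \<in> carrier F" for \<alpha> f
    using that by (auto simp: crossed_homs_def)
  have "inj_on ?T ?A"
  proof (rule inj_onI)
    fix \<alpha> \<beta> assume \<alpha>: "\<alpha> \<in> ?A" and \<beta>: "\<beta> \<in> ?A" and eq: "?T \<alpha> = ?T \<beta>"
    have "\<alpha> (dg f) = \<beta> (dg f)" if f: "f \<in> carrier F" for f
      using fun_cong[OF eq, of f] f \<alpha>_in[OF \<alpha> f] \<alpha>_in[OF \<beta> f]
      by (simp add: tail_stabilizer_carrier)
    then have "\<alpha> a = \<beta> a" if "a \<in> carrier M" for a
      using dg_surj[OF that] by blast
    moreover have "\<alpha> \<in> extensional (carrier M)" "\<beta> \<in> extensional (carrier M)"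
      using \<alpha> \<beta> by (auto simp: crossed_homs_def PiE_def)
    ultimately show "\<alpha> = \<beta>"
      by (intro extensionalityI)
  qed
  moreover have "?T \<alpha> \<in> ?B" if \<alpha>: "\<alpha> \<in> ?A" for \<alpha>
  proof -
    have carr [simp]: "\<alpha> (dg f) \<in> carrier G" if "f \<in> carrier F" for f
      using \<alpha>_in[OF \<alpha> that] by (rule tail_stabilizer_carrier)
    have cross: "\<alpha> (a \<otimes>\<^bsub>M\<^esub> b) = tail_action b (\<alpha> a) \<otimes>\<^bsub>G\<^esub> \<alpha> b"
      if "a \<in> carrier M" "b \<in> carrier M" for a b
      using \<alpha> that by (simp add: crossed_homs_def)
    have "\<phi> (f \<otimes>\<^bsub>F\<^esub> g) \<otimes>\<^bsub>G\<^esub> \<alpha> (dg (f \<otimes>\<^bsub>F\<^esub> g)) = (\<phi> f \<otimes>\<^bsub>G\<^esub> \<alpha> (dg f)) \<otimes>\<^bsub>G\<^esub> (\<phi> g \<otimes>\<^bsub>G\<^esub> \<alpha> (dg g))"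
      if "f \<in> carrier F" "g \<in> carrier F" for f g
      using that \<alpha>_in[OF \<alpha>]
      by (simp add: \<phi>_mult dg_mult cross tail_action_dg G.m_assoc G.inv_mult_cancel_left)
    then have "?T \<alpha> \<in> hom_ext F G"
      by (auto simp: hom_ext_def hom_def)
    \<comment> \<open>This gives agreement with \<open>\<phi>\<close> on the kernel. The crossed law
      at the identity makes the value idempotent.\<close>
    moreover have "\<alpha> \<one>\<^bsub>M\<^esub> = \<one>\<^bsub>G\<^esub>"
    proof -
      have one: "dg \<one>\<^bsub>F\<^esub> = \<one>\<^bsub>M\<^esub>"
        by (rule group_hom.hom_one[OF dg_hom])
      have 1: "\<alpha> \<one>\<^bsub>M\<^esub> \<in> tail_stabilizer"
        using \<alpha>_in[OF \<alpha>, of "\<one>\<^bsub>F\<^esub>"] one by simp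
      have "tail_action \<one>\<^bsub>M\<^esub> (\<alpha> \<one>\<^bsub>M\<^esub>) = \<alpha> \<one>\<^bsub>M\<^esub>"
        using right_action_tail_action 1 by (simp add: right_action_by_automorphisms_def)
      then have "\<alpha> \<one>\<^bsub>M\<^esub> = \<alpha> \<one>\<^bsub>M\<^esub> \<otimes>\<^bsub>G\<^esub> \<alpha> \<one>\<^bsub>M\<^esub>"
        using cross[of "\<one>\<^bsub>M\<^esub>" "\<one>\<^bsub>M\<^esub>"] by simp
      then show ?thesis
        using tail_stabilizer_carrier[OF 1] G.r_cancel_one' by metis
    qed
    then have "same_tail (?T \<alpha>)"
      using \<alpha>_in[OF \<alpha>]
      by (auto simp: same_tail_def kernel_iff G.inv_mult_cancel_left tail_stabilizer_def)
    ultimately show ?thesis by simp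
  qed
  moreover have "\<psi> \<in> ?T ` ?A" if \<psi>: "\<psi> \<in> ?B" for \<psi>
  proof -
    have hom: "\<psi> \<in> hom F G" and ext: "\<psi> \<in> extensional (carrier F)" and tail: "same_tail \<psi>"
      using \<psi> by (auto simp: hom_ext_def)
    note q = quotient_of_same_tail[OF hom tail]
    \<comment> \<open>The quotient is evaluated at an arbitrary lift; since it depends only on the
      degree, any lift yields the same value.\<close>
    define \<alpha> where "\<alpha> = (\<lambda>a\<in>carrier M. let f = inv_into (carrier F) dg a in inv\<^bsub>G\<^esub> \<phi> f \<otimes>\<^bsub>G\<^esub> \<psi> f)"
    have \<alpha>: "\<alpha> (dg f) = inv\<^bsub>G\<^esub> \<phi> f \<otimes>\<^bsub>G\<^esub> \<psi> f" if "f \<in> carrier F" for f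
      using that q(3)[of "inv_into (carrier F) dg (dg f)" f]
      by (simp add: \<alpha>_def Let_def inv_into_into f_inv_into_f)
    have "\<alpha> (a \<otimes>\<^bsub>M\<^esub> b) = tail_action b (\<alpha> a) \<otimes>\<^bsub>G\<^esub> \<alpha> b"
      if "a \<in> carrier M" "b \<in> carrier M" for a b
    proof -
      obtain f g where fg: "f \<in> carrier F" "a = dg f" "g \<in> carrier F" "b = dg g"
        using dg_surj \<open>a \<in> carrier M\<close> \<open>b \<in> carrier M\<close> by metis
      then show ?thesis
        using \<alpha>[of "f \<otimes>\<^bsub>F\<^esub> g"] q(1)[of f g] q(2)[of f]
        by (simp add: \<alpha> tail_action_dg dg_mult)
    qed
    moreover have "\<alpha> a \<in> tail_stabilizer" if "a \<in> carrier M" for a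
      using dg_surj[OF that] \<alpha> q(2) by force
    moreover have "\<alpha> \<in> extensional (carrier M)"
      by (simp add: \<alpha>_def)
    ultimately have "\<alpha> \<in> ?A"
      by (auto simp: crossed_homs_def PiE_def)
    moreover have "\<psi> = ?T \<alpha>"
    proof (rule extensionalityI[OF ext])
      show "\<psi> f = ?T \<alpha> f" if "f \<in> carrier F" for f
        using that hom by (auto simp: \<alpha> hom_def G.inv_mult_cancel_left Pi_iff)
    qed simp
    ultimately show ?thesis by blast
  qed
  ultimately show ?thesis
    unfolding bij_betw_def by blast
qed

end

section \<open>Conjugation by \<open>H\<close> on the given set of homomorphisms\<close>

theorem theorem2p7:
  fixes M :: "('m, 'x) monoid_scheme"
    and F :: "('f, 'y) monoid_scheme"
    and G :: "('g, 'z) monoid_scheme"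
    and H :: "'g set"
    and dg :: "'f \<Rightarrow> 'm"
    and \<Phi> :: "('f \<Rightarrow> 'g) set"
  assumes "comm_group M"
    and "finitely_generated_group M"
    and "group G"
    and "subgroup H G"
    and "group F"
    and "dg \<in> epi F M"
    and "\<Phi> \<subseteq> hom_ext F G"
    and conj_invariant:
      "\<And>\<phi> h. \<phi> \<in> \<Phi> \<Longrightarrow> h \<in> H \<Longrightarrow>
         (\<lambda>f\<in>carrier F. inv\<^bsub>G\<^esub> h \<otimes>\<^bsub>G\<^esub> \<phi> f \<otimes>\<^bsub>G\<^esub> h) \<in> \<Phi>"
    and tail_closed:
      "\<And>\<phi> \<psi>. \<phi> \<in> \<Phi> \<Longrightarrow> \<psi> \<in> hom_ext F G \<Longrightarrow>
         hom_tail F M dg G H \<psi> = hom_tail F M dg G H \<phi> \<Longrightarrow> \<psi> \<in> \<Phi>"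
    and crossed_homs_divisible:
      "\<And>H' act. subgroup H' (G\<lparr>carrier := H\<rparr>) \<Longrightarrow>
         right_action_by_automorphisms M (G\<lparr>carrier := H'\<rparr>) act \<Longrightarrow>
         card_dvd H' (crossed_homs M (G\<lparr>carrier := H'\<rparr>) act)"
  shows "card_dvd H \<Phi>"
proof -
  interpret M: group M using assms(1) by (rule comm_group.axioms(2))
  interpret F: group F by fact
  interpret G: group G by fact
  \<comment> \<open>Restriction to the carrier keeps conjugates extensional, as membership in
    \<open>\<Phi>\<close> demands.\<close>
  let ?act = "\<lambda>h \<phi>. \<lambda>f\<in>carrier F. G.conj_by h (\<phi> f)"
  have loc: "tailed_hom M F G H dg \<phi>" if "\<phi> \<in> \<Phi>" for \<phi>
    using that assms(4,6,7)
    by (intro tailed_hom.intro tailed_hom_axioms.intro M.is_group F.is_group G.is_group)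
      (auto simp: hom_ext_def)
  have H_carrier: "h \<in> carrier G" if "h \<in> H" for h
    using that assms(4) subgroup.mem_carrier by metis
  have \<Phi>_closed: "\<phi> f \<in> carrier G" if "\<phi> \<in> \<Phi>" "f \<in> carrier F" for \<phi> f
    using that assms(7) by (auto simp: hom_ext_def hom_def)
  have tail_iff: "hom_tail F M dg G H \<psi> = hom_tail F M dg G H \<phi>
      \<longleftrightarrow> tailed_hom.same_tail M F G H dg \<phi> \<psi>"
    if "\<phi> \<in> \<Phi>" "\<psi> \<in> \<Phi>" for \<phi> \<psi>
    using tailed_hom.hom_tail_eq_iff[OF loc[OF that(1)]] \<Phi>_closed[OF that(2)] by blast
  interpret fibred_right_action "G\<lparr>carrier := H\<rparr>" \<Phi> ?act "hom_tail F M dg G H"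
  proof (intro fibred_right_action.intro fibred_right_action_axioms.intro)
    show "group (G\<lparr>carrier := H\<rparr>)"
      using assms(3,4) by (simp add: subgroup.subgroup_is_group)
    show "?act h \<phi> \<in> \<Phi>" if "h \<in> carrier (G\<lparr>carrier := H\<rparr>)" "\<phi> \<in> \<Phi>" for h \<phi>
      using that conj_invariant by simp
    show "?act \<one>\<^bsub>G\<lparr>carrier := H\<rparr>\<^esub> \<phi> = \<phi>" if "\<phi> \<in> \<Phi>" for \<phi>
    proof (rule extensionalityI[where A = "carrier F"])
      show "\<phi> \<in> extensional (carrier F)"
        using that assms(7) by (auto simp: hom_ext_def)
    qed (use \<Phi>_closed[OF that] in auto)
    show "?act (g \<otimes>\<^bsub>G\<lparr>carrier := H\<rparr>\<^esub> h) \<phi> = ?act h (?act g \<phi>)"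
      if "g \<in> carrier (G\<lparr>carrier := H\<rparr>)" "h \<in> carrier (G\<lparr>carrier := H\<rparr>)" "\<phi> \<in> \<Phi>" for g h \<phi>
      using that by (intro restrict_ext) (simp add: G.conj_by_conj_by H_carrier \<Phi>_closed)
    \<comment> \<open>The quotient of the conjugates is the conjugate of the quotient, and it stays
      in \<open>H\<close> because \<open>h\<close> is in \<open>H\<close>.\<close>
    show "hom_tail F M dg G H (?act h \<phi>) = hom_tail F M dg G H (?act h \<psi>)"
      if h: "h \<in> carrier (G\<lparr>carrier := H\<rparr>)" and \<phi>: "\<phi> \<in> \<Phi>" and \<psi>: "\<psi> \<in> \<Phi>"
        and eq: "hom_tail F M dg G H \<phi> = hom_tail F M dg G H \<psi>" for h \<phi> \<psi>
    proof -
      have hH: "h \<in> H" using h by simp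
      note st = tailed_hom.same_tail_def[OF loc]
      have "tailed_hom.same_tail M F G H dg \<psi> \<phi>"
        using eq tail_iff[OF \<psi> \<phi>] by simp
      then have 1: "\<forall>k\<in>kernel F M dg. \<phi> k = \<psi> k"
        and 2: "\<And>f. f \<in> carrier F \<Longrightarrow> inv\<^bsub>G\<^esub> \<psi> f \<otimes>\<^bsub>G\<^esub> \<phi> f \<in> H"
        by (auto simp: st[OF \<psi>])
      have "inv\<^bsub>G\<^esub> (G.conj_by h (\<psi> f)) \<otimes>\<^bsub>G\<^esub> G.conj_by h (\<phi> f) \<in> H" if f: "f \<in> carrier F" for f
      proof -
        have "inv\<^bsub>G\<^esub> (G.conj_by h (\<psi> f)) \<otimes>\<^bsub>G\<^esub> G.conj_by h (\<phi> f) = G.conj_by h (inv\<^bsub>G\<^esub> \<psi> f \<otimes>\<^bsub>G\<^esub> \<phi> f)"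
          using f hH \<phi> \<psi>
          by (simp add: H_carrier \<Phi>_closed G.conj_by_mult G.conj_by_inv)
        then show ?thesis
          using 2[OF f] hH assms(4) by (simp add: subgroup.m_closed subgroup.m_inv_closed)
      qed
      then have "tailed_hom.same_tail M F G H dg (?act h \<psi>) (?act h \<phi>)"
        using 1 conj_invariant[OF \<psi> hH] by (auto simp: st kernel_def)
      then show ?thesis
        using tail_iff conj_invariant \<phi> \<psi> hH by simp
    qed
  qed
  have "card_dvd (fibre_stabilizer \<phi>) (fibre \<phi>)" if in\<Phi>: "\<phi> \<in> \<Phi>" for \<phi>
  proof -
    interpret tailed_hom M F G H dg \<phi> by (rule loc[OF in\<Phi>])
    have "fibre_stabilizer \<phi> = tail_stabilizer"
      using tail_iff[OF in\<Phi> conj_invariant[OF in\<Phi>]] same_tail_conj_iff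
      by (auto simp: fibre_stabilizer_def tail_stabilizer_def)
    \<comment> \<open>Closure of \<open>\<Phi>\<close> under equal tails ensures that the fibre
      inside \<open>\<Phi>\<close> contains every homomorphism with this tail, so the bijection with
      crossed homomorphisms counts all of it.\<close>
    moreover have "fibre \<phi> = {\<psi> \<in> hom_ext F G. same_tail \<psi>}"
      using tail_closed[OF in\<Phi>] assms(7) tail_iff[OF in\<Phi>] hom_tail_eq_iff
      by (auto simp: fibre_def hom_ext_def hom_def)
    ultimately show ?thesis
      using crossed_homs_divisible[OF subgroup_tail_stabilizer right_action_tail_action]
        bij_betw_crossed_homs_same_tail
      by (simp add: card_dvd_bij_betw)
  qed
  from card_dvd_carrier[OF this] show ?thesis by simp
qed

end
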